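(* Let $G\le\mathrm{Homeo}_+(S^1)$ be a subgroup with no non-abelian free subgroups. Then the family $\{\mathrm{Fix}(g)\mid g\in G_0\}$ satisfies the finite intersection property, i.e. for every $n$ and all $n$-tuples $g_1,\ldots,g_n\in G_0$ we have $\mathrm{Fix}(g_1)\cap\cdots\cap\mathrm{Fix}(g_n)\neq\emptyset$.
   Context: $\mathrm{Homeo}_+(S^1)$ is the group of orientation-preserving homeomorphisms of the circle $S^1$. For $g\in\mathrm{Homeo}_+(S^1)$, $\mathrm{Fix}(g)=\{s\in S^1\mid g(s)=s\}$. For a subgroup $G\le\mathrm{Homeo}_+(S^1)$, $G_0=\{g\in G\mid\mathrm{Fix}(g)\neq\emptyset\}$. *)

theory Defs
  imports "HOL-Analysis.Analysis" "HOL-Algebra.Bij"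
begin

abbreviation unit_circle :: "complex set" where
  "unit_circle \<equiv> sphere 0 1"

(* A homeomorphism of the circle preserves the orientation iff it lifts to an increasing
   map of the line, along the universal covering cis :: real => complex of period 2 * pi. *)
definition orientation_preserving :: "(complex \<Rightarrow> complex) \<Rightarrow> bool" where
  "orientation_preserving f \<longleftrightarrow>
     (\<exists>F :: real \<Rightarrow> real. continuous_on UNIV F \<and> strict_mono F \<and> (\<forall>t. f (cis t) = cis (F t)))"

(* Maps of the circle are extensional functions on the complex plane, as in Bij,
   so that HOL equality is equality of maps of the circle. *)
definition homeo_plus_circle :: "(complex \<Rightarrow> complex) set" where
  "homeo_plus_circle =
     {f \<in> Bij unit_circle.
        (\<exists>g. homeomorphism unit_circle unit_circle f g) \<and> orientation_preserving f}"

definition HomeoPlus :: "(complex \<Rightarrow> complex) monoid" where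
  "HomeoPlus = BijGroup unit_circle \<lparr>carrier := homeo_plus_circle\<rparr>"

definition Fix :: "(complex \<Rightarrow> complex) \<Rightarrow> complex set" where
  "Fix g = {s \<in> unit_circle. g s = s}"

definition with_fixpoint :: "(complex \<Rightarrow> complex) set \<Rightarrow> (complex \<Rightarrow> complex) set" where
  "with_fixpoint G = {g \<in> G. Fix g \<noteq> {}}"

(* The letter (x, True) stands for x, and (x, False) for the formal inverse of x. *)
definition reduced_words :: "'a set \<Rightarrow> ('a \<times> bool) list set" where
  "reduced_words X =
     {w \<in> lists (X \<times> UNIV). successively (\<lambda>(x, a) (y, b). \<not> (x = y \<and> a \<noteq> b)) w}"

fun word_value :: "('a, 'b) monoid_scheme \<Rightarrow> ('a \<times> bool) list \<Rightarrow> 'a" where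
  "word_value H [] = \<one>\<^bsub>H\<^esub>"
| "word_value H ((x, a) # w) = (if a then x else inv\<^bsub>H\<^esub> x) \<otimes>\<^bsub>H\<^esub> word_value H w"

(* H is free on X iff every element is the value of exactly one reduced word over X.
   The trivial group is free on {}. *)
definition free_group_on :: "('a, 'b) monoid_scheme \<Rightarrow> 'a set \<Rightarrow> bool" where
  "free_group_on H X \<longleftrightarrow>
     group H \<and> X \<subseteq> carrier H \<and> bij_betw (word_value H) (reduced_words X) (carrier H)"

definition free_group :: "('a, 'b) monoid_scheme \<Rightarrow> bool" where
  "free_group H \<longleftrightarrow> (\<exists>X. free_group_on H X)"

definition has_nonabelian_free_subgroup :: "('a, 'b) monoid_scheme \<Rightarrow> bool" where
  "has_nonabelian_free_subgroup H \<longleftrightarrow>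
     (\<exists>K. subgroup K H \<and> free_group (H\<lparr>carrier := K\<rparr>) \<and> \<not> comm_group (H\<lparr>carrier := K\<rparr>))"

lemma orientation_preserving_compose:
  assumes "orientation_preserving f" "orientation_preserving g"
  shows "orientation_preserving (compose unit_circle f g)"
proof -
  obtain F G where F: "continuous_on UNIV F" "strict_mono F" "\<And>t. f (cis t) = cis (F t)"
    and G: "continuous_on UNIV G" "strict_mono G" "\<And>t. g (cis t) = cis (G t)"
    using assms unfolding orientation_preserving_def by blast
  have "continuous_on UNIV (F \<circ> G)"
    using F(1) G(1) continuous_on_compose continuous_on_subset by blast
  moreover have "strict_mono (F \<circ> G)"
    using F(2) G(2) by (simp add: strict_mono_def)
  moreover have "\<forall>t. compose unit_circle f g (cis t) = cis ((F \<circ> G) t)"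
    using F(3) G(3) by (simp add: compose_def)
  ultimately show ?thesis
    unfolding orientation_preserving_def by blast
qed

lemma orientation_preserving_inverse:
  assumes f: "f \<in> Bij unit_circle" and op: "orientation_preserving f"
  shows "orientation_preserving (\<lambda>x\<in>unit_circle. inv_into unit_circle f x)"
proof -
  obtain F where F: "continuous_on UNIV F" "strict_mono F" "\<And>t. f (cis t) = cis (F t)"
    using op unfolding orientation_preserving_def by blast
  have step: "F (t + 2 * pi) \<ge> F t + 2 * pi" for t
  proof -
    have "cis (t + 2 * pi) = cis t" by (simp add: cis.ctr)
    then have "cis (F (t + 2 * pi)) = cis (F t)" by (metis F(3))
    then have "sin (F (t + 2 * pi)) = sin (F t) \<and> cos (F (t + 2 * pi)) = cos (F t)"
      by (metis cis.sel)
    then obtain n :: int where n: "F (t + 2 * pi) = F t + 2 * pi * of_int n"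
      using sin_cos_eq_iff by (metis mult.assoc mult.commute)
    have "F t < F (t + 2 * pi)" using F(2) by (simp add: strict_mono_def)
    then have "n \<ge> 1" using n by (simp add: zero_less_mult_iff)
    then show ?thesis using n by simp
  qed
  have up: "F (2 * pi * real n) \<ge> F 0 + 2 * pi * real n" for n
  proof (induction n)
    case (Suc n)
    then show ?case using step[of "2 * pi * real n"] by (simp add: algebra_simps)
  qed simp
  have down: "F (- (2 * pi * real n)) \<le> F 0 - 2 * pi * real n" for n
  proof (induction n)
    case (Suc n)
    then show ?case using step[of "- (2 * pi * real (Suc n))"] by (simp add: algebra_simps)
  qed simp
  have surj: "\<exists>t. F t = y" for y
  proof -
    obtain n where "real n > \<bar>y - F 0\<bar>" using reals_Archimedean2 by blast
    moreover have "2 * pi * real n \<ge> 1 * real n"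
      using pi_gt3 by (intro mult_right_mono) auto
    ultimately have n: "2 * pi * real n > \<bar>y - F 0\<bar>" by linarith
    have "F (- (2 * pi * real n)) \<le> y" "y \<le> F (2 * pi * real n)"
      using up[of n] down[of n] n by linarith+
    then show ?thesis
      using IVT'[of F "- (2 * pi * real n)" y "2 * pi * real n"]
      by (meson F(1) continuous_on_subset subset_UNIV neg_le_0_iff_le order_trans
          mult_nonneg_nonneg of_nat_0_le_iff pi_ge_zero zero_le_numeral)
  qed
  have inj: "inj F" using F(2) strict_mono_imp_inj_on by blast
  have r: "range F = UNIV" using surj by (auto simp: image_iff) metis
  have FG: "F (inv_into UNIV F y) = y" for y using r by (simp add: f_inv_into_f)
  have mono: "strict_mono (inv_into UNIV F)"
    by (metis FG F(2) strict_mono_def strict_mono_less)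
  have "open (F ` U)" if "open U" for U
  proof -
    obtain g where "homeomorphism UNIV (range F) F g"
      using invariance_of_domain_homeomorphism[OF open_UNIV F(1) _ inj] by auto
    then show ?thesis
      using homeomorphism_imp_open_map[of UNIV UNIV F g U] r that by (simp add: openin_open_eq)
  qed
  moreover have "inv_into UNIV F -` B = F ` B" for B
    using inj FG by (auto simp: image_iff) metis
  ultimately have cont: "continuous_on UNIV (inv_into UNIV F)"
    by (simp add: continuous_on_open_vimage)
  have "inv_into unit_circle f (cis t) = cis (inv_into UNIV F t)" for t
    by (rule inv_into_f_eq) (use f F(3) FG in \<open>auto simp: Bij_def bij_betw_def\<close>)
  then show ?thesis
    unfolding orientation_preserving_def using mono cont by (intro exI[of _ "inv_into UNIV F"]) simp
qed

lemma subgroup_homeo_plus_circle: "subgroup homeo_plus_circle (BijGroup unit_circle)"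
proof (rule group.subgroupI[OF group_BijGroup])
  show "homeo_plus_circle \<subseteq> carrier (BijGroup unit_circle)"
    by (auto simp: homeo_plus_circle_def BijGroup_def)
  have "homeomorphism unit_circle unit_circle (\<lambda>x\<in>unit_circle. x) (\<lambda>x. x)"
    by (auto simp: homeomorphism_def intro: continuous_on_eq[OF continuous_on_id])
  moreover have "orientation_preserving (\<lambda>x\<in>unit_circle. x)"
    unfolding orientation_preserving_def by (intro exI[of _ "\<lambda>t. t"]) (auto simp: strict_mono_def)
  ultimately show "homeo_plus_circle \<noteq> {}"
    using id_Bij unfolding homeo_plus_circle_def by blast
next
  fix f assume "f \<in> homeo_plus_circle"
  then obtain g where f: "f \<in> Bij unit_circle" "orientation_preserving f"
    and g: "homeomorphism unit_circle unit_circle f g"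
    by (auto simp: homeo_plus_circle_def)
  let ?i = "\<lambda>x\<in>unit_circle. inv_into unit_circle f x"
  have eq: "?i x = g x" if x: "x \<in> unit_circle" for x
  proof -
    have "inv_into unit_circle f x = g x"
      by (rule inv_into_f_eq) (use f g x in \<open>auto simp: Bij_def bij_betw_def homeomorphism_def\<close>)
    with x show ?thesis by simp
  qed
  have "homeomorphism unit_circle unit_circle ?i f"
    using homeomorphism_cong[OF homeomorphism_symD[OF g] refl refl, of ?i f] eq by simp
  then show "inv\<^bsub>BijGroup unit_circle\<^esub> f \<in> homeo_plus_circle"
    using f orientation_preserving_inverse[OF f] restrict_inv_into_Bij[OF f(1)]
    unfolding homeo_plus_circle_def inv_BijGroup[OF f(1)] by blast
next
  fix f g assume "f \<in> homeo_plus_circle" "g \<in> homeo_plus_circle"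
  then obtain f' g' where f: "f \<in> Bij unit_circle" "orientation_preserving f"
      "homeomorphism unit_circle unit_circle f f'"
    and g: "g \<in> Bij unit_circle" "orientation_preserving g"
      "homeomorphism unit_circle unit_circle g g'"
    by (auto simp: homeo_plus_circle_def)
  have "homeomorphism unit_circle unit_circle (compose unit_circle f g) (g' \<circ> f')"
    using homeomorphism_cong[OF homeomorphism_compose[OF g(3) f(3)] refl refl,
        of "compose unit_circle f g" "g' \<circ> f'"] by (simp add: compose_def)
  then show "f \<otimes>\<^bsub>BijGroup unit_circle\<^esub> g \<in> homeo_plus_circle"
    using f g orientation_preserving_compose compose_Bij
    by (auto simp: BijGroup_def homeo_plus_circle_def)
qed

lemma group_HomeoPlus: "group HomeoPlus"
  unfolding HomeoPlus_def
  by (rule subgroup.subgroup_is_group[OF subgroup_homeo_plus_circle group_BijGroup])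

end

theory Submission
  imports Defs "HOL-Algebra.Group_Action"
begin

text \<open>
  If \<open>Fix f\<close> and \<open>Fix g\<close> are disjoint and nonempty, high powers of \<open>f\<close> and \<open>g\<close> push the
  complement of a neighbourhood of their fixed points into that neighbourhood, hence play ping-pong
  and generate a free group. For finitely many maps one adds one map \<open>g\<close> at a time. Suppose that
  the set \<open>K\<close> of common fixed points of the earlier maps is nonempty but misses \<open>Fix g\<close>. The
  elements of \<open>G\<close> that fix a point of \<open>K\<close> form a group which, on the circle cut at that point,
  has no common fixed point outside \<open>K\<close>. A single element of this group displaces finitely many compact
  intervals covering \<open>Fix g\<close>; it has fixed points, but none in \<open>Fix g\<close>, contradicting the case
  of two maps.
\<close>

section \<open>Free subgroups and ping-pong\<close>

lemma Nil_in_reduced_words [simp]: "[] \<in> reduced_words X"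
  by (simp add: reduced_words_def)

lemma Cons_in_reduced_words:
  "(x, e) # w \<in> reduced_words X \<longleftrightarrow>
     x \<in> X \<and> w \<in> reduced_words X \<and> (w \<noteq> [] \<longrightarrow> hd w \<noteq> (x, \<not> e))"
  by (cases w) (auto simp: reduced_words_def)

context group
begin

abbreviation letter :: "'a \<Rightarrow> bool \<Rightarrow> 'a" where
  "letter x e \<equiv> if e then x else inv x"

lemma word_value_closed:
  assumes "X \<subseteq> carrier G" "w \<in> reduced_words X"
  shows "word_value G w \<in> carrier G"
  using assms(2)
proof (induction w)
  case (Cons l w)
  then show ?case
    using assms(1) by (cases l) (auto simp: Cons_in_reduced_words)
qed simp

text \<open>A new first letter either keeps the word reduced or cancels against its head, leaving
  the reduced tail. So closure under products and inverses can be proved letter by letter, without a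
  normal form for arbitrary words.\<close>

lemma letter_mult_reduced_value:
  assumes X: "X \<subseteq> carrier G" and x: "x \<in> X"
  shows "u \<in> word_value G ` reduced_words X \<Longrightarrow>
    letter x e \<otimes> u \<in> word_value G ` reduced_words X"
proof -
  assume "u \<in> word_value G ` reduced_words X"
  then obtain w where w: "w \<in> reduced_words X" "u = word_value G w" by blast
  show ?thesis
  proof (cases "w \<noteq> [] \<and> hd w = (x, \<not> e)")
    case False
    then have "(x, e) # w \<in> reduced_words X"
      using w x by (auto simp: Cons_in_reduced_words)
    moreover have "letter x e \<otimes> u = word_value G ((x, e) # w)"
      using w by simp
    ultimately show ?thesis by blast
  next
    case True
    then obtain v where v: "w = (x, \<not> e) # v" by (cases w) auto
    then have v': "v \<in> reduced_words X"
      using w by (simp add: Cons_in_reduced_words)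
    have "letter x e \<otimes> u = word_value G v"
      using X x word_value_closed[OF X v'] w v by (auto simp: m_assoc[symmetric])
    with v' show ?thesis by blast
  qed
qed

lemma subgroup_reduced_values:
  assumes X: "X \<subseteq> carrier G"
  shows "subgroup (word_value G ` reduced_words X) G"
proof -
  let ?K = "word_value G ` reduced_words X"
  have one: "\<one> \<in> ?K"
    by (rule image_eqI[where x = "[]"]) auto
  have mult: "word_value G w \<otimes> u \<in> ?K" if "w \<in> reduced_words X" "u \<in> ?K" for w u
    using that
  proof (induction w)
    case Nil
    then show ?case using word_value_closed[OF X] by auto
  next
    case (Cons l w)
    obtain x e where l: "l = (x, e)" by (cases l)
    have xw: "x \<in> X" "w \<in> reduced_words X"
      using Cons.prems l by (auto simp: Cons_in_reduced_words)
    have "u \<in> carrier G" using Cons.prems word_value_closed[OF X] by auto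
    then have "word_value G (l # w) \<otimes> u = letter x e \<otimes> (word_value G w \<otimes> u)"
      using xw X word_value_closed[OF X] l by (auto simp: m_assoc subset_iff)
    also have "\<dots> \<in> ?K"
      by (rule letter_mult_reduced_value[OF X xw(1) Cons.IH[OF xw(2) Cons.prems(2)]])
    finally show ?case .
  qed
  have inv: "inv (word_value G w) \<in> ?K" if "w \<in> reduced_words X" for w
    using that
  proof (induction w)
    case Nil
    then show ?case using one by simp
  next
    case (Cons l w)
    obtain x e where l: "l = (x, e)" by (cases l)
    have xw: "x \<in> X" "w \<in> reduced_words X"
      using Cons.prems l by (auto simp: Cons_in_reduced_words)
    have "letter x (\<not> e) \<in> ?K"
      using letter_mult_reduced_value[OF X xw(1) one, of "\<not> e"] xw X by (auto split: if_splits)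
    moreover have "inv (word_value G (l # w)) = inv (word_value G w) \<otimes> letter x (\<not> e)"
    proof -
      have "x \<in> carrier G" using X xw(1) by blast
      then show ?thesis
        using word_value_closed[OF X xw(2)] l by (simp add: inv_mult_group)
    qed
    moreover obtain v where "v \<in> reduced_words X" "inv (word_value G w) = word_value G v"
      using Cons.IH[OF xw(2)] by (rule imageE)
    ultimately show ?case
      using mult by simp
  qed
  show ?thesis
  proof (rule subgroupI)
    show "?K \<subseteq> carrier G" using word_value_closed[OF X] by blast
    show "?K \<noteq> {}" using one by blast
    show "inv u \<in> ?K" if "u \<in> ?K" for u using that inv by (elim imageE) simp
    show "u \<otimes> v \<in> ?K" if "u \<in> ?K" "v \<in> ?K" for u v
      using that(1) mult[OF _ that(2)] by (elim imageE) simp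
  qed
qed

text \<open>Two words with equal values are compared by first letters. Equal letters cancel;
  otherwise the first letter of one word moves, inverted, in front of the other. The second word may
  grow this way, hence the induction on \<open>v\<close> with \<open>w\<close> arbitrary.\<close>

lemma inj_on_word_value:
  assumes X: "X \<subseteq> carrier G"
    and nontriv: "\<And>w. w \<in> reduced_words X \<Longrightarrow> w \<noteq> [] \<Longrightarrow> word_value G w \<noteq> \<one>"
  shows "inj_on (word_value G) (reduced_words X)"
proof -
  have "w = v" if "v \<in> reduced_words X" "w \<in> reduced_words X" "word_value G w = word_value G v"
    for v w
    using that
  proof (induction v arbitrary: w)
    case Nil
    then show ?case using nontriv by auto
  next
    case (Cons l v)
    obtain y d where l: "l = (y, d)" by (cases l)
    have yv: "y \<in> X" "v \<in> reduced_words X"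
      using Cons.prems l by (auto simp: Cons_in_reduced_words)
    have cy: "y \<in> carrier G" using X yv by blast
    have cv: "word_value G v \<in> carrier G" by (rule word_value_closed[OF X yv(2)])
    show ?case
    proof (cases "w \<noteq> [] \<and> hd w = (y, d)")
      case True
      then obtain u where u: "w = (y, d) # u" by (cases w) auto
      then have u': "u \<in> reduced_words X"
        using Cons.prems by (simp add: Cons_in_reduced_words)
      have "word_value G u = word_value G v"
        using Cons.prems(3) u l cy cv word_value_closed[OF X u'] by (auto split: if_splits)
      then show ?thesis using Cons.IH[OF yv(2) u'] u l by simp
    next
      case False
      then have red: "(y, \<not> d) # w \<in> reduced_words X"
        using Cons.prems yv by (auto simp: Cons_in_reduced_words)
      have "word_value G ((y, \<not> d) # w) = letter y (\<not> d) \<otimes> (letter y d \<otimes> word_value G v)"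
        using Cons.prems(3) l by simp
      also have "\<dots> = word_value G v"
        using cy cv by (auto simp: m_assoc[symmetric])
      \<comment> \<open>Then \<open>v\<close> would start with the inverse of the letter
        \<open>l\<close> in front of it, although \<open>l # v\<close> is reduced.\<close>
      finally have "(y, \<not> d) # w = v"
        using Cons.IH[OF yv(2) red] by blast
      then show ?thesis
        using Cons.prems(1) l by (auto simp: Cons_in_reduced_words)
    qed
  qed
  then show ?thesis by (auto intro: inj_onI)
qed

lemma has_nonabelian_free_subgroupI:
  assumes ab: "a \<in> carrier G" "b \<in> carrier G" "a \<noteq> b"
    and nontriv: "\<And>w. w \<in> reduced_words {a, b} \<Longrightarrow> w \<noteq> [] \<Longrightarrow> word_value G w \<noteq> \<one>"
  shows "has_nonabelian_free_subgroup G"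
proof -
  let ?X = "{a, b}"
  let ?K = "word_value G ` reduced_words ?X"
  let ?H = "G\<lparr>carrier := ?K\<rparr>"
  have X: "?X \<subseteq> carrier G" using ab by simp
  have K: "subgroup ?K G" by (rule subgroup_reduced_values[OF X])
  have inj: "inj_on (word_value G) (reduced_words ?X)"
    by (rule inj_on_word_value[OF X nontriv])
  have letters: "[(x, True)] \<in> reduced_words ?X" "x = word_value G [(x, True)]" if "x \<in> ?X" for x
    using that X by (auto simp: Cons_in_reduced_words)
  have XK: "?X \<subseteq> ?K" using letters by blast
  have val: "word_value ?H w = word_value G w" if "w \<in> reduced_words ?X" for w
    using that
  proof (induction w)
    case (Cons l w)
    then show ?case
      using m_inv_consistent[OF K] XK by (cases l) (auto simp: Cons_in_reduced_words)
  qed simp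
  have "bij_betw (word_value ?H) (reduced_words ?X) ?K"
    using inj val by (simp add: bij_betw_def cong: inj_on_cong image_cong)
  then have "free_group_on ?H ?X"
    using subgroup_imp_group[OF K] XK by (simp add: free_group_on_def)
  moreover have "\<not> comm_group ?H"
  proof
    assume "comm_group ?H"
    then have comm: "a \<otimes> b = b \<otimes> a"
      using XK comm_monoid.m_comm[of ?H a b] by (simp add: comm_group_def)
    have "[(a, True), (b, True)] = [(b, True), (a, True)]"
      by (rule inj_onD[OF inj]) (use ab comm in \<open>auto simp: Cons_in_reduced_words\<close>)
    with ab show False by simp
  qed
  ultimately show ?thesis
    unfolding has_nonabelian_free_subgroup_def free_group_def
    by (intro exI[of _ ?K] conjI exI[of _ ?X] K)
qed

end

text \<open>The base point \<open>p\<close> lies outside both \<open>U\<close> and \<open>V\<close>,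
  so every nonempty reduced word sends it into \<open>U\<close> or \<open>V\<close> and cannot act
  as the identity. This treats all words uniformly, with no conjugation to adjust their first and
  last letters.\<close>

lemma (in group_action) ping_pong:
  assumes ab: "a \<in> carrier G" "b \<in> carrier G"
    and UV: "U \<inter> V = {}" and p: "p \<in> E" "p \<notin> U" "p \<notin> V"
    and a: "\<And>k::int. k \<noteq> 0 \<Longrightarrow> \<phi> (a [^] k) ` (E - U) \<subseteq> U"
    and b: "\<And>k::int. k \<noteq> 0 \<Longrightarrow> \<phi> (b [^] k) ` (E - V) \<subseteq> V"
  shows "has_nonabelian_free_subgroup G"
proof -
  interpret group G using group_hom group_hom.axioms(1) by auto
  have a1: "\<phi> a p \<in> U" using a[of 1] p ab by (auto simp: int_pow_1)
  have b1: "\<phi> b p \<in> V" using b[of 1] p ab by (auto simp: int_pow_1)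
  have neq: "a \<noteq> b" using a1 b1 UV by auto
  let ?D = "\<lambda>x. if x = a then U else V"
  let ?s = "\<lambda>e. if e then 1 else - 1 :: int"
  have into: "\<phi> (x [^] k) y \<in> ?D x" if "x \<in> {a, b}" "k \<noteq> 0" "y \<in> E" "y \<notin> ?D x"
    for x y and k :: int
    using that a[of k] b[of k] neq by auto
  have out: "y \<notin> ?D x" if "y \<in> ?D x'" "x \<in> {a, b}" "x' \<in> {a, b}" "x \<noteq> x'" for x x' y
    using that UV neq by (auto split: if_splits)
  have pow: "x [^] (?s e * int k) \<otimes> letter x e = x [^] (?s e * int (Suc k))"
    if "x \<in> carrier G" for x e k
  proof (cases e)
    case True
    then show ?thesis
      using int_pow_mult[OF that, of "int k" 1] that by (simp add: int_pow_1 add.commute)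
  next
    case False
    have "x [^] (- int k) \<otimes> x [^] (- 1 :: int) = x [^] (- int (Suc k))"
      using int_pow_mult[OF that, of "- int k" "- 1"] by (simp add: add.commute)
    then show ?thesis
      using False that by (simp add: int_pow_neg int_pow_1)
  qed
  have closed: "word_value G w \<in> carrier G" if "w \<in> reduced_words {a, b}" for w
    using word_value_closed[OF _ that] ab by simp
  \<comment> \<open>The extra factor, a power of \<open>x\<close> with the sign of the first letter,
    collects a run of equal letters: the induction removes one letter at a time, while the
    hypotheses apply to the whole run as a single power. The claim itself is the case
    \<open>k = 0\<close>.\<close>
  have main: "\<phi> (x [^] (?s e * int k) \<otimes> word_value G ((x, e) # w)) p \<in> ?D x"
    if "(x, e) # w \<in> reduced_words {a, b}" for x e w k
    using that
  proof (induction w arbitrary: x e k)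
    case Nil
    then have x: "x \<in> {a, b}" by (simp add: Cons_in_reduced_words)
    have "x [^] (?s e * int k) \<otimes> word_value G [(x, e)] = x [^] (?s e * int (Suc k))"
      using pow[of x e k] x ab by auto
    moreover have "p \<notin> ?D x" using p by auto
    ultimately show ?case using into[OF x, of "?s e * int (Suc k)" p] p by auto
  next
    case (Cons l w)
    obtain y d where l: "l = (y, d)" by (cases l)
    have x: "x \<in> {a, b}" and y: "y \<in> {a, b}" and lw: "(y, d) # w \<in> reduced_words {a, b}"
      and ne: "(y, d) \<noteq> (x, \<not> e)"
      using Cons.prems l by (auto simp: Cons_in_reduced_words)
    let ?v = "word_value G ((y, d) # w)"
    have xc: "x \<in> carrier G" using x ab by auto
    have v: "?v \<in> carrier G" by (rule closed[OF lw])
    have "x [^] (?s e * int k) \<otimes> word_value G ((x, e) # l # w)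
        = x [^] (?s e * int k) \<otimes> (letter x e \<otimes> ?v)"
      using l by simp
    also have "\<dots> = x [^] (?s e * int (Suc k)) \<otimes> ?v"
      unfolding pow[OF xc, symmetric] by (rule m_assoc[symmetric]) (use xc v in auto)
    finally have step: "x [^] (?s e * int k) \<otimes> word_value G ((x, e) # l # w)
        = x [^] (?s e * int (Suc k)) \<otimes> ?v" .
    \<comment> \<open>If \<open>y = x\<close>, reducedness forces equal signs and the run grows by
      one. If not, the run ends here: the tail has sent \<open>p\<close> into \<open>?D y\<close>,
      outside \<open>?D x\<close>, so the power of \<open>x\<close> sends it into
      \<open>?D x\<close>.\<close>
    show ?case
    proof (cases "y = x")
      case True
      with ne have "d = e" by auto
      with True Cons.IH[OF lw, of "Suc k"] show ?thesis unfolding step by simp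
    next
      case False
      have "\<phi> ?v p \<in> ?D y" using Cons.IH[OF lw, of 0] v by simp
      then have "\<phi> ?v p \<notin> ?D x" using out x y False by metis
      moreover have "\<phi> ?v p \<in> E" using element_image[OF v p(1)] by simp
      ultimately have "\<phi> (x [^] (?s e * int (Suc k))) (\<phi> ?v p) \<in> ?D x"
        by (intro into[OF x]) auto
      then show ?thesis
        unfolding step using composition_rule[OF p(1) _ v] xc by simp
    qed
  qed
  show ?thesis
  proof (rule has_nonabelian_free_subgroupI[OF ab neq])
    fix w assume w: "w \<in> reduced_words {a, b}" "w \<noteq> []"
    then obtain x e u where xeu: "w = (x, e) # u" by (cases w) auto
    have "\<phi> (word_value G w) p \<in> ?D x"
      using main[of x e u 0] w closed[OF w(1)] xeu by simp
    moreover have "\<phi> \<one> p = p" using id_eq_one p(1) by (metis restrict_apply')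
    ultimately show "word_value G w \<noteq> \<one>" using p by (auto split: if_splits)
  qed
qed

section \<open>Displacing intervals of the line\<close>

text \<open>The supremum of the orbit of \<open>a\<close> is fixed by the whole group
  \<open>M\<close>, because each element permutes the orbit and preserves order. If the orbit stayed
  below \<open>b\<close>, this would be a common fixed point in the interval.\<close>

lemma displace_interval:
  fixes M :: "(real \<Rightarrow> real) set"
  assumes mono: "\<And>k. k \<in> M \<Longrightarrow> strict_mono k"
    and id: "id \<in> M"
    and comp: "\<And>k l. k \<in> M \<Longrightarrow> l \<in> M \<Longrightarrow> k \<circ> l \<in> M"
    and inv: "\<And>k. k \<in> M \<Longrightarrow> \<exists>l\<in>M. k \<circ> l = id"
    and ab: "a \<le> b"
    and nofix: "\<And>z. a \<le> z \<Longrightarrow> z \<le> b \<Longrightarrow> \<exists>k\<in>M. k z \<noteq> z"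
  shows "\<exists>k\<in>M. b < k a"
proof (rule ccontr)
  assume "\<not> ?thesis"
  then have le: "k a \<le> b" if "k \<in> M" for k using that by force
  let ?s = "SUP k\<in>M. k a"
  have bdd: "bdd_above ((\<lambda>k. k a) ` M)" using le by (rule bdd_aboveI2)
  have up: "k a \<le> ?s" if "k \<in> M" for k using cSUP_upper[OF that bdd] .
  have "a \<le> ?s" using up[OF id] by simp
  moreover have "?s \<le> b" by (rule cSUP_least) (use id le in auto)
  ultimately obtain k where k: "k \<in> M" "k ?s \<noteq> ?s" using nofix by blast
  have ge: "?s \<le> k ?s" if k: "k \<in> M" for k
  proof (rule cSUP_least)
    show "M \<noteq> {}" using id by auto
    fix l assume l: "l \<in> M"
    obtain k' where k': "k' \<in> M" "k \<circ> k' = id" using inv[OF k] by blast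
    have "l a = k (k' (l a))" using k'(2) by (metis comp_apply id_apply)
    also have "\<dots> \<le> k ?s"
      using up[OF comp[OF k'(1) l]] strict_mono_less_eq[OF mono[OF k]] by simp
    finally show "l a \<le> k ?s" .
  qed
  obtain k' where k': "k' \<in> M" "k \<circ> k' = id" using inv[OF k(1)] by blast
  have "k ?s \<le> k (k' ?s)"
    using ge[OF k'(1)] strict_mono_less_eq[OF mono[OF k(1)]] by simp
  also have "\<dots> = ?s" using k'(2) by (metis comp_apply id_apply)
  finally show False using ge[OF k(1)] k(2) by simp
qed

text \<open>Induction on the number of intervals. Some \<open>k\<close> displaces the new interval
  alone. The induction hypothesis, applied to enlarged old intervals, gives an \<open>h\<close> such
  that \<open>h\<close>, \<open>k' \<circ> (k' \<circ> h)\<close> and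
  \<open>k' \<circ> (h \<circ> k)\<close> all displace the old ones; one of the three also displaces
  the new one.\<close>

lemma displace_intervals:
  fixes M :: "(real \<Rightarrow> real) set" and a b :: "'i \<Rightarrow> real"
  assumes mono: "\<And>k. k \<in> M \<Longrightarrow> strict_mono k"
    and id: "id \<in> M"
    and comp: "\<And>k l. k \<in> M \<Longrightarrow> l \<in> M \<Longrightarrow> k \<circ> l \<in> M"
    and inv: "\<And>k. k \<in> M \<Longrightarrow> \<exists>l\<in>M. k \<circ> l = id"
    and fin: "finite I"
    and ab: "\<And>i. i \<in> I \<Longrightarrow> a i \<le> b i"
    and nofix: "\<And>i z. i \<in> I \<Longrightarrow> a i \<le> z \<Longrightarrow> z \<le> b i \<Longrightarrow> \<exists>k\<in>M. k z \<noteq> z"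
  shows "\<exists>h\<in>M. \<forall>i\<in>I. b i < h (a i) \<or> h (b i) < a i"
  using fin ab nofix
proof (induction I arbitrary: a b)
  case empty
  then show ?case using id by auto
next
  case (insert m I)
  have "\<exists>k\<in>M. b m < k (a m)"
    by (rule displace_interval[OF mono id comp inv insert.prems(1)])
      (use insert.prems(2)[of m] in auto)
  then obtain k where k: "k \<in> M" "b m < k (a m)" by blast
  obtain k' where k': "k' \<in> M" "k \<circ> k' = id" using inv[OF k(1)] by blast
  have kk': "k (k' t) = t" for t using k'(2) by (metis comp_apply id_apply)
  have lt: "h x < h y \<longleftrightarrow> x < y" if "h \<in> M" for h x y
    using strict_mono_less[OF mono[OF that]] .
  have lt': "k' x < y \<longleftrightarrow> x < k y" "x < k' y \<longleftrightarrow> k x < y" for x y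
    using lt[OF k(1), of "k' x" y] lt[OF k(1), of x "k' y"] kk' by simp_all
  \<comment> \<open>The enlarged interval is the hull of the old one and its images under
    \<open>k\<close> and \<open>k \<circ> k\<close>, the only images that occur when the three
    candidates are compared with the identity.\<close>
  define a' where "a' i = min (a i) (min (k (a i)) (k (k (a i))))" for i
  define b' where "b' i = max (b i) (max (k (b i)) (k (k (b i))))" for i
  have "\<exists>h\<in>M. \<forall>i\<in>I. b' i < h (a' i) \<or> h (b' i) < a' i"
  proof (rule insert.IH)
    fix i assume i: "i \<in> I"
    then show "a' i \<le> b' i" using insert.prems(1)[of i] by (auto simp: a'_def b'_def)
    fix z assume z: "a' i \<le> z" "z \<le> b' i"
    show "\<exists>h\<in>M. h z \<noteq> z"
    proof (rule ccontr)
      assume "\<not> ?thesis"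
      \<comment> \<open>A common fixed point \<open>z\<close> lies outside the old interval, and
        \<open>k\<close> fixes \<open>z\<close>; so the interval and both images stay on one side of
        \<open>z\<close>, and \<open>z\<close> is outside their hull.\<close>
      then have "k z = z" "\<not> (a i \<le> z \<and> z \<le> b i)"
        using insert.prems(2)[of i z] k i by auto
      moreover have "k x < z \<longleftrightarrow> x < z" "z < k x \<longleftrightarrow> z < x" for x
        using lt[OF k(1), of x z] lt[OF k(1), of z x] \<open>k z = z\<close> by simp_all
      ultimately show False
        using z insert.prems(1)[of i] i unfolding a'_def b'_def
        by (smt (verit) insertCI)
    qed
  qed
  then obtain h where h: "h \<in> M" "\<And>i. i \<in> I \<Longrightarrow> b' i < h (a' i) \<or> h (b' i) < a' i" by blast
  \<comment> \<open>Since \<open>h\<close> pushes the hull off itself to one side, comparisons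
    between points of the hull and images of such points all have the same direction.\<close>
  have sep: "y < h x \<and> y' < h x' \<or> h x < y \<and> h x' < y'"
    if "i \<in> I" "{x, x', y, y'} \<subseteq> {a' i..b' i}" for i x x' y y'
  proof -
    have "h (a' i) \<le> h x" "h (a' i) \<le> h x'" "h x \<le> h (b' i)" "h x' \<le> h (b' i)"
      using that strict_mono_less_eq[OF mono[OF h(1)]] by auto
    then show ?thesis using h(2)[OF that(1)] that(2) by fastforce
  qed
  have hull: "{a i, b i, k (a i), k (b i), k (k (a i)), k (k (b i))} \<subseteq> {a' i..b' i}"
    if "i \<in> I" for i
    using insert.prems(1)[of i] that strict_mono_less_eq[OF mono[OF k(1)]]
    unfolding a'_def b'_def by (auto simp: min_le_iff_disj le_max_iff_disj)
  have off: "b i < w (a i) \<or> w (b i) < a i"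
    if "w \<in> {h, k' \<circ> (k' \<circ> h), k' \<circ> (h \<circ> k)}" "i \<in> I" for w i
    using sep[OF that(2), of "a i" "b i" "b i" "a i"]
      sep[OF that(2), of "a i" "b i" "k (k (b i))" "k (k (a i))"]
      sep[OF that(2), of "k (a i)" "k (b i)" "k (b i)" "k (a i)"]
      hull[OF that(2)] that(1)
    by (auto simp: lt')
  \<comment> \<open>With \<open>J\<close> the interval to displace, if \<open>h J\<close> meets both \<open>J\<close> and \<open>k (k J)\<close>, it contains
     \<open>k J\<close>, so that \<open>h (k J)\<close> lies beyond \<open>k J\<close>.\<close>
  have "\<exists>w\<in>{h, k' \<circ> (k' \<circ> h), k' \<circ> (h \<circ> k)}. b m < w (a m) \<or> w (b m) < a m"
  proof (rule ccontr)
    assume "\<not> ?thesis"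
    then have n: "\<not> h (b m) < k (k (a m))" "\<not> k (b m) < h (k (a m))"
      by (auto simp: lt')
    have "k (b m) < k (k (a m))" using k lt by blast
    also have "\<dots> \<le> h (b m)" using n by simp
    also have "\<dots> < h (k (a m))" using k(2) lt[OF h(1)] by blast
    finally show False using n by simp
  qed
  then obtain w where w: "w \<in> {h, k' \<circ> (k' \<circ> h), k' \<circ> (h \<circ> k)}"
    "b m < w (a m) \<or> w (b m) < a m" by blast
  have "w \<in> M" using w(1) h(1) k(1) k'(1) comp by blast
  then show ?case using w off by blast
qed

text \<open>Here \<open>K\<close> contains all common fixed points of \<open>M\<close>. Finitely
  many balls cover \<open>L\<close> whose closures miss \<open>K\<close>; displacing these closed
  intervals moves every point of \<open>L\<close> out of its own interval.\<close>

lemma displace_compact: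
  fixes M :: "(real \<Rightarrow> real) set"
  assumes mono: "\<And>k. k \<in> M \<Longrightarrow> strict_mono k"
    and id: "id \<in> M"
    and comp: "\<And>k l. k \<in> M \<Longrightarrow> l \<in> M \<Longrightarrow> k \<circ> l \<in> M"
    and inv: "\<And>k. k \<in> M \<Longrightarrow> \<exists>l\<in>M. k \<circ> l = id"
    and L: "compact L"
    and K: "closed K" "\<And>z. (\<And>k. k \<in> M \<Longrightarrow> k z = z) \<Longrightarrow> z \<in> K" "K \<inter> L = {}"
  shows "\<exists>h\<in>M. \<forall>x\<in>L. h x \<noteq> x"
proof -
  have "\<exists>e>0. cball x e \<inter> K = {}" if "x \<in> L" for x
  proof -
    have "x \<in> - K" "open (- K)" using that K by auto
    then show ?thesis
      using open_contains_cball[of "- K"] by blast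
  qed
  then obtain e where e: "\<And>x. x \<in> L \<Longrightarrow> e x > 0 \<and> cball x (e x) \<inter> K = {}" by metis
  obtain I where I: "I \<subseteq> L" "finite I" "L \<subseteq> (\<Union>x\<in>I. ball x (e x))"
    by (rule compactE_image[OF L, of L "\<lambda>x. ball x (e x)"]) (use e in auto)
  have "\<exists>h\<in>M. \<forall>x\<in>I. x + e x < h (x - e x) \<or> h (x + e x) < x - e x"
  proof (rule displace_intervals[OF mono id comp inv I(2)])
    fix x assume "x \<in> I"
    then have x: "x \<in> L" using I by blast
    then show "x - e x \<le> x + e x" using e[OF x] by simp
    fix z assume "x - e x \<le> z" "z \<le> x + e x"
    then have "z \<in> cball x (e x)" by (auto simp: dist_real_def)
    then show "\<exists>k\<in>M. k z \<noteq> z" using e[OF x] K(2) by blast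
  qed auto
  then obtain h where h: "h \<in> M" "\<And>x. x \<in> I \<Longrightarrow> x + e x < h (x - e x) \<or> h (x + e x) < x - e x"
    by blast
  have "h y \<noteq> y" if y: "y \<in> L" for y
  proof -
    obtain x where x: "x \<in> I" "y \<in> ball x (e x)" using I y by blast
    then have "x - e x < y" "y < x + e x" by (auto simp: dist_real_def)
    then have "h (x - e x) < h y" "h y < h (x + e x)"
      using mono[OF h(1)] by (auto simp: strict_mono_def)
    with h(2)[OF x(1)] \<open>x - e x < y\<close> \<open>y < x + e x\<close> show ?thesis by auto
  qed
  then show ?thesis using h(1) by blast
qed

section \<open>Fixed points of circle homeomorphisms\<close>

lemma cis_eq_iff_int: "cis s = cis t \<longleftrightarrow> (\<exists>n::int. s = t + 2 * pi * n)"
  using sin_cos_eq_iff[of s t] by (auto simp: complex_eq_iff)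

lemma isCont_cis: "isCont cis t"
  unfolding cis_conv_exp by (intro continuous_intros)

text \<open>Dividing by \<open>cis t0\<close> measures the argument from \<open>t0\<close>, so the
  circle can be cut at any chosen point.\<close>

lemma unit_circle_cisE:
  assumes "x \<in> unit_circle"
  obtains t where "t0 \<le> t" "t < t0 + 2 * pi" "x = cis t"
proof -
  let ?z = "x / cis t0"
  have "norm ?z = 1" using assms by (simp add: norm_divide)
  then have "?z = cis (Arg2pi ?z)"
    using complex_norm_eq_1_exp[of ?z] by (simp add: cis_conv_exp)
  then have "x = cis (t0 + Arg2pi ?z)"
    by (simp add: cis_mult[symmetric] nonzero_divide_eq_eq mult.commute)
  then show thesis
    using that[of "t0 + Arg2pi ?z"] Arg2pi_ge_0[of ?z] Arg2pi_lt_2pi[of ?z] by simp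
qed

text \<open>A lift is determined up to multiples of \<open>2 * pi\<close>; one of them fixes
  \<open>t0\<close>. Injectivity on the circle forces degree one, so this lift also fixes
  \<open>t0 + 2 * pi\<close>, and \<open>g\<close> becomes an increasing bijection of the circle cut
  at the fixed point.\<close>

lemma lift_with_fixpoint:
  assumes g: "g \<in> homeo_plus_circle" and fix0: "g (cis t0) = cis t0"
  obtains F where "continuous_on UNIV F" "strict_mono F" "surj F" "F t0 = t0"
    "F (t0 + 2 * pi) = t0 + 2 * pi" "\<And>t. g (cis t) = cis (F t)"
proof -
  have inj: "inj_on g unit_circle"
    using g by (auto simp: homeo_plus_circle_def Bij_def bij_betw_def)
  obtain F' where F': "continuous_on UNIV F'" "strict_mono F'" "\<And>t. g (cis t) = cis (F' t)"
    using g unfolding homeo_plus_circle_def orientation_preserving_def by blast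
  obtain n :: int where n: "F' t0 = t0 + 2 * pi * n"
    using F'(3)[of t0] fix0 cis_eq_iff_int[of "F' t0" t0] by auto
  define F where "F t = F' t - 2 * pi * n" for t
  have cont: "continuous_on UNIV F"
    unfolding F_def by (intro continuous_intros F'(1))
  have mono: "strict_mono F"
    using F'(2) by (simp add: F_def strict_mono_def)
  have F: "g (cis t) = cis (F t)" for t
    unfolding F'(3) cis_eq_iff_int F_def by (intro exI[of _ n]) simp
  have F0: "F t0 = t0" using n by (simp add: F_def)
  have per: "F (t + 2 * pi) = F t + 2 * pi" for t
  proof -
    have "cis (t + 2 * pi) = cis t" by (simp add: cis_mult[symmetric])
    then have "cis (F (t + 2 * pi)) = cis (F t)" by (metis F)
    then obtain m :: int where m: "F (t + 2 * pi) = F t + 2 * pi * m"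
      by (auto simp: cis_eq_iff_int)
    have "F t < F (t + 2 * pi)" using mono by (simp add: strict_mono_def)
    then have "m \<ge> 1" using m by (simp add: zero_less_mult_iff)
    \<comment> \<open>Otherwise the lift would reach \<open>F t + 2 * pi\<close> strictly inside a
      period, and two distinct points of the circle would have the same image.\<close>
    moreover have "\<not> m \<ge> 2"
    proof
      assume "m \<ge> 2"
      then have "2 * pi * 2 \<le> 2 * pi * real_of_int m" by (intro mult_left_mono) auto
      then have "F t + 2 * pi < F (t + 2 * pi)" using m pi_gt_zero by linarith
      moreover have "F t \<le> F t + 2 * pi" by simp
      ultimately obtain u where u: "t \<le> u" "u \<le> t + 2 * pi" "F u = F t + 2 * pi"
        using IVT'[of F t "F t + 2 * pi" "t + 2 * pi"] continuous_on_subset[OF cont] by force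
      have "cis (F u) = cis (F t)" using u(3) by (simp add: cis_mult[symmetric])
      then have "cis u = cis t" using inj F by (simp add: inj_on_def)
      then obtain j :: int where j: "u = t + 2 * pi * j" by (auto simp: cis_eq_iff_int)
      have "u \<noteq> t" "u \<noteq> t + 2 * pi"
        using u(3) \<open>F t + 2 * pi < F (t + 2 * pi)\<close> by auto
      then have "0 < 2 * pi * real_of_int j" "2 * pi * real_of_int j < 2 * pi * 1"
        using u(1,2) j by linarith+
      then have "0 < real_of_int j" "real_of_int j < 1"
        using zero_less_mult_pos[of "2 * pi" "real_of_int j"]
          mult_less_cancel_left_pos[of "2 * pi" "real_of_int j" 1] by (simp_all del: mult_less_cancel_left_pos)
      then show False by simp
    qed
    ultimately have "m = 1" by simp
    then show ?thesis using m by simp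
  qed
  have up: "F (t0 + 2 * pi * real k) = t0 + 2 * pi * real k" for k
  proof (induction k)
    case (Suc k)
    then show ?case using per[of "t0 + 2 * pi * real k"] by (simp add: algebra_simps)
  qed (simp add: F0)
  have down: "F (t0 - 2 * pi * real k) = t0 - 2 * pi * real k" for k
  proof (induction k)
    case (Suc k)
    then show ?case using per[of "t0 - 2 * pi * real (Suc k)"] by (simp add: algebra_simps)
  qed (simp add: F0)
  have "\<exists>t. y = F t" for y
  proof -
    obtain k where k: "real k > \<bar>y - t0\<bar> / (2 * pi)" using reals_Archimedean2 by blast
    then have "\<bar>y - t0\<bar> < 2 * pi * real k" by (simp add: field_simps)
    then have "F (t0 - 2 * pi * real k) \<le> y" "y \<le> F (t0 + 2 * pi * real k)"
      "t0 - 2 * pi * real k \<le> t0 + 2 * pi * real k"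
      unfolding up down by linarith+
    then show ?thesis
      using IVT'[of F] continuous_on_subset[OF cont] by (metis subset_UNIV)
  qed
  then have "surj F" by (simp add: surj_def)
  moreover have "F (t0 + 2 * pi) = t0 + 2 * pi" using per[of t0] F0 by simp
  ultimately show thesis using that[OF cont mono _ F0 _ F] by blast
qed

section \<open>Iterates and attraction to the fixed point set\<close>

lemma closed_Fix:
  assumes "g \<in> homeo_plus_circle"
  shows "closed (Fix g)"
proof -
  have "continuous_on unit_circle (\<lambda>x. g x - x)"
    using assms by (auto simp: homeo_plus_circle_def homeomorphism_def intro!: continuous_intros)
  then have "closed {x \<in> unit_circle. g x - x = 0}"
    by (rule continuous_closed_preimage_constant) simp
  then show ?thesis by (simp add: Fix_def)
qed

text \<open>The orbit is monotone and trapped between the fixed points \<open>c\<close> and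
  \<open>d\<close>; continuity makes its limit a fixed point.\<close>

lemma funpow_converges_to_fixpoint:
  fixes F :: "real \<Rightarrow> real"
  assumes cont: "continuous_on UNIV F" and mono: "strict_mono F"
    and c: "F c = c" and d: "F d = d" and x: "c \<le> x" "x \<le> d"
  obtains p where "F p = p" "(\<lambda>n. (F ^^ n) x) \<longlonglongrightarrow> p"
proof -
  have le: "F s \<le> F t \<longleftrightarrow> s \<le> t" for s t using strict_mono_less_eq[OF mono] .
  have bnd: "c \<le> (F ^^ n) x \<and> (F ^^ n) x \<le> d" for n
  proof (induction n)
    case (Suc n)
    then show ?case using le[of c] le[of _ d] c d by simp
  qed (use x in simp)
  have "monoseq (\<lambda>n. (F ^^ n) x)"
  proof (cases "x \<le> F x")
    case True
    have "(F ^^ n) x \<le> (F ^^ Suc n) x" for n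
      by (induction n) (use True le in auto)
    then show ?thesis by (simp add: monoseq_Suc)
  next
    case False
    have "(F ^^ Suc n) x \<le> (F ^^ n) x" for n
      by (induction n) (use False le in auto)
    then show ?thesis by (simp add: monoseq_Suc)
  qed
  moreover have "Bseq (\<lambda>n. (F ^^ n) x)"
    using bnd by (intro BseqI'[of _ "\<bar>c\<bar> + \<bar>d\<bar>"]) (smt (verit) real_norm_def)
  ultimately obtain p where p: "(\<lambda>n. (F ^^ n) x) \<longlonglongrightarrow> p"
    using Bseq_monoseq_convergent convergentD by blast
  have "isCont F p" using cont by (simp add: continuous_on_eq_continuous_at)
  from isCont_tendsto_compose[OF this p] have "(\<lambda>n. (F ^^ Suc n) x) \<longlonglongrightarrow> F p" by simp
  then have "F p = p" using LIMSEQ_unique LIMSEQ_Suc[OF p] by blast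
  with p show thesis using that by blast
qed

text \<open>Each orbit converges to a fixed point, hence enters \<open>U\<close> for good.
  Compactness of the complement of \<open>U\<close> makes the time of entry uniform, once it is
  uniform near each point.\<close>

lemma funpow_attracted:
  assumes g: "g \<in> homeo_plus_circle" and ne: "Fix g \<noteq> {}" and U: "open U" "Fix g \<subseteq> U"
  obtains N where "\<And>n x. n \<ge> N \<Longrightarrow> x \<in> unit_circle - U \<Longrightarrow> (g ^^ n) x \<in> U"
proof -
  obtain t0 where t0: "g (cis t0) = cis t0"
  proof -
    obtain x where x: "x \<in> unit_circle" "g x = x" using ne by (auto simp: Fix_def)
    obtain t where "x = cis t" using unit_circle_cisE[OF x(1)] by metis
    with x(2) that show thesis by simp
  qed
  obtain F where F: "continuous_on UNIV F" "strict_mono F" "F t0 = t0"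
      "F (t0 + 2 * pi) = t0 + 2 * pi" "\<And>t. g (cis t) = cis (F t)"
    using lift_with_fixpoint[OF g t0] by metis
  have gF: "(g ^^ n) (cis t) = cis ((F ^^ n) t)" for n t
    by (induction n) (simp_all add: F(5))
  have lt: "(F ^^ n) s < (F ^^ n) t" if "s < t" for n s t
    by (induction n) (use that F(2) in \<open>auto simp: strict_mono_def\<close>)
  have W: "open (cis -` U)" using continuous_open_vimage[OF U(1) isCont_cis] .
  define C where "C = {t0..t0 + 2 * pi} - cis -` U"
  \<comment> \<open>An open set around a non-fixed \<open>x\<close>: for \<open>u\<close> in it, the
    \<open>n\<close>-th iterate of \<open>u\<close> lies between the iterates of \<open>x\<close> of
    orders \<open>n - 1\<close> and \<open>n + 1\<close>, so the orbit of \<open>x\<close> controls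
    that of \<open>u\<close>.\<close>
  define O' where "O' x = {u. x < F u \<and> u < F x} \<union> {u. F u < x \<and> F x < u}" for x
  have C: "compact C" unfolding C_def by (rule compact_diff[OF compact_Icc W])
  have "\<exists>N. \<forall>n\<ge>N. \<forall>u\<in>O' x. (F ^^ n) u \<in> cis -` U" if x: "x \<in> C" for x
  proof -
    obtain p where p: "F p = p" "(\<lambda>n. (F ^^ n) x) \<longlonglongrightarrow> p"
      using funpow_converges_to_fixpoint[OF F(1-4)] x by (auto simp: C_def)
    have "p \<in> cis -` U" using U(2) p(1) F(5)[of p] by (auto simp: Fix_def)
    then obtain e where e: "e > 0" "ball p e \<subseteq> cis -` U" using W open_contains_ball by blast
    obtain N where N: "\<And>n. n \<ge> N \<Longrightarrow> dist ((F ^^ n) x) p < e"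
      using p(2) e(1) unfolding lim_sequentially by blast
    \<comment> \<open>The bound is \<open>Suc N\<close> because the iterate of order
      \<open>n - 1\<close> must already be close to \<open>p\<close>.\<close>
    have "(F ^^ n) u \<in> cis -` U" if n: "n \<ge> Suc N" and u: "u \<in> O' x" for n u
    proof -
      obtain m where m: "n = Suc m" using n by (cases n) auto
      have "(F ^^ m) x < (F ^^ n) u \<and> (F ^^ n) u < (F ^^ Suc n) x \<or>
          (F ^^ n) u < (F ^^ m) x \<and> (F ^^ Suc n) x < (F ^^ n) u"
        using u lt[of x "F u" m] lt[of "F u" x m] lt[of u "F x" n] lt[of "F x" u n]
        unfolding O'_def m by (auto simp: funpow_swap1)
      then have "dist ((F ^^ n) u) p < e"
        using N[of m] N[of "Suc n"] n m by (auto simp: dist_real_def)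
      then show ?thesis using e(2) by (auto simp: dist_commute)
    qed
    then show ?thesis by blast
  qed
  then obtain N where N: "\<And>x n u. x \<in> C \<Longrightarrow> n \<ge> N x \<Longrightarrow> u \<in> O' x \<Longrightarrow> (F ^^ n) u \<in> cis -` U"
    by metis
  have "open (O' x)" for x
    unfolding O'_def by (intro open_Un open_Collect_conj open_Collect_less F(1) continuous_intros)
  moreover have "x \<in> O' x" if "x \<in> C" for x
  proof -
    have "F x \<noteq> x"
    proof
      assume "F x = x"
      then have "cis x \<in> Fix g" using F(5)[of x] by (simp add: Fix_def)
      then show False using that U(2) by (auto simp: C_def)
    qed
    then show ?thesis by (auto simp: O'_def)
  qed
  ultimately obtain I where I: "I \<subseteq> C" "finite I" "C \<subseteq> (\<Union>x\<in>I. O' x)"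
    by (meson UN_I compactE_image[OF C, of C O'] subsetI)
  show thesis
  proof (rule that)
    \<comment> \<open>Inserting \<open>0\<close> keeps the maximum meaningful when \<open>I\<close>
      is empty.\<close>
    fix n y assume n: "n \<ge> Max (insert 0 (N ` I))" and y: "y \<in> unit_circle - U"
    obtain t where t: "t0 \<le> t" "t < t0 + 2 * pi" "y = cis t"
      using y unit_circle_cisE[of y t0] by blast
    then have "t \<in> C" using y by (auto simp: C_def)
    then obtain x where x: "x \<in> I" "t \<in> O' x" using I(3) by blast
    have "N x \<le> n" using n x(1) I(2) by simp
    then show "(g ^^ n) y \<in> U" using N[OF _ _ x(2), of n] x(1) I(1) gF t(3) by auto
  qed
qed

section \<open>Subgroups acting on the circle: two maps, then finitely many\<close>

context
  fixes G :: "(complex \<Rightarrow> complex) set"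
  assumes G: "subgroup G HomeoPlus"
begin

abbreviation (input) \<Gamma> where "\<Gamma> \<equiv> HomeoPlus\<lparr>carrier := G\<rparr>"

lemma mem_homeo: "g \<in> G \<Longrightarrow> g \<in> homeo_plus_circle"
  using subgroup.subset[OF G] by (auto simp: HomeoPlus_def)

lemma circle_action: "group_action \<Gamma> unit_circle (\<lambda>g. g)"
proof -
  have "group \<Gamma>" using group.subgroup_imp_group[OF group_HomeoPlus G] .
  moreover have "(\<lambda>g. g) \<in> hom \<Gamma> (BijGroup unit_circle)"
    using mem_homeo by (auto simp: hom_def HomeoPlus_def BijGroup_def homeo_plus_circle_def)
  ultimately show ?thesis
    by (simp add: group_action_def group_hom_def group_hom_axioms_def group_BijGroup)
qed

interpretation group_action \<Gamma> unit_circle "\<lambda>g. g" by (rule circle_action)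

interpretation group \<Gamma> using group_hom group_hom.axioms(1) by blast

lemma nat_pow_apply:
  assumes "g \<in> G" "x \<in> unit_circle"
  shows "(g [^]\<^bsub>\<Gamma>\<^esub> (n::nat)) x = (g ^^ n) x"
  using assms(2)
proof (induction n arbitrary: x)
  case 0
  then show ?case using id_eq_one by (metis funpow_0 nat_pow_0 restrict_apply')
next
  case (Suc n)
  have "g x \<in> unit_circle" using element_image[of g x] assms(1) Suc.prems by simp
  then show ?case
    using Suc composition_rule[of x "g [^]\<^bsub>\<Gamma>\<^esub> n" g] nat_pow_closed[of g n] assms(1)
    by (simp add: funpow_swap1)
qed

lemma inv_homeo_fixes_iff:
  assumes "g \<in> G" "x \<in> unit_circle"
  shows "(inv\<^bsub>\<Gamma>\<^esub> g) x = x \<longleftrightarrow> g x = x"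
  using orbit_sym_aux[of g x x] orbit_sym_aux[of "inv\<^bsub>\<Gamma>\<^esub> g" x x] assms inv_closed[of g]
  by auto

text \<open>The inverse of \<open>g\<close> has the same fixed points, so it is attracted to
  \<open>U\<close> as well. An exponent \<open>N\<close> that serves both also serves every nonzero
  multiple, which is the ping-pong condition for the \<open>N\<close>-th power of
  \<open>g\<close>.\<close>

lemma int_pow_attracted:
  assumes g: "g \<in> G" and ne: "Fix g \<noteq> {}" and U: "open U" "Fix g \<subseteq> U"
  obtains N :: nat where
    "\<And>k::int. k \<noteq> 0 \<Longrightarrow> ((g [^]\<^bsub>\<Gamma>\<^esub> N) [^]\<^bsub>\<Gamma>\<^esub> k) ` (unit_circle - U) \<subseteq> U"
proof -
  let ?i = "inv\<^bsub>\<Gamma>\<^esub> g"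
  have i: "?i \<in> G" using inv_closed[of g] g by simp
  have Fix: "Fix ?i = Fix g" using inv_homeo_fixes_iff[OF g] by (auto simp: Fix_def)
  obtain N1 where N1: "\<And>n x. n \<ge> N1 \<Longrightarrow> x \<in> unit_circle - U \<Longrightarrow> (g ^^ n) x \<in> U"
    using funpow_attracted[OF mem_homeo[OF g] ne U] by blast
  obtain N2 where N2: "\<And>n x. n \<ge> N2 \<Longrightarrow> x \<in> unit_circle - U \<Longrightarrow> (?i ^^ n) x \<in> U"
    using funpow_attracted[OF mem_homeo[OF i], unfolded Fix, OF ne U] by blast
  define N where "N = max N1 N2"
  show thesis
  proof (rule that)
    fix k :: int assume k: "k \<noteq> 0"
    define j where "j = nat \<bar>k\<bar>"
    have "N * 1 \<le> N * j" using k by (intro mult_left_mono) (auto simp: j_def)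
    then have N: "N1 \<le> N * j" "N2 \<le> N * j" by (auto simp: N_def)
    have pow: "(g [^]\<^bsub>\<Gamma>\<^esub> N) [^]\<^bsub>\<Gamma>\<^esub> j = g [^]\<^bsub>\<Gamma>\<^esub> (N * j)"
      by (rule nat_pow_pow) (simp add: g)
    show "((g [^]\<^bsub>\<Gamma>\<^esub> N) [^]\<^bsub>\<Gamma>\<^esub> k) ` (unit_circle - U) \<subseteq> U"
    proof (cases "k > 0")
      case True
      then have "(g [^]\<^bsub>\<Gamma>\<^esub> N) [^]\<^bsub>\<Gamma>\<^esub> k = g [^]\<^bsub>\<Gamma>\<^esub> (N * j)"
        unfolding pow[symmetric] by (simp only: j_def int_pow_def2) simp
      then show ?thesis by (auto simp: nat_pow_apply[OF g] intro: N1[OF N(1)])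
    next
      case False
      then have "(g [^]\<^bsub>\<Gamma>\<^esub> N) [^]\<^bsub>\<Gamma>\<^esub> k = inv\<^bsub>\<Gamma>\<^esub> (g [^]\<^bsub>\<Gamma>\<^esub> (N * j))"
        unfolding pow[symmetric] using k by (simp only: j_def int_pow_def2) simp
      also have "\<dots> = ?i [^]\<^bsub>\<Gamma>\<^esub> (N * j)"
        by (rule nat_pow_inv[symmetric]) (simp add: g)
      finally show ?thesis by (auto simp: nat_pow_apply[OF i] intro: N2[OF N(2)])
    qed
  qed
qed

lemma disjoint_Fix_imp_free:
  assumes f: "f \<in> G" "Fix f \<noteq> {}" and g: "g \<in> G" "Fix g \<noteq> {}" and disj: "Fix f \<inter> Fix g = {}"
  shows "has_nonabelian_free_subgroup \<Gamma>"
proof -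
  obtain U V where UV: "open U" "open V" "Fix f \<subseteq> U" "Fix g \<subseteq> V" "U \<inter> V = {}"
    using separation_normal[OF closed_Fix[OF mem_homeo[OF f(1)]]
        closed_Fix[OF mem_homeo[OF g(1)]] disj] .
  \<comment> \<open>Both open sets meet the connected circle and they are disjoint, so they cannot
    cover it. This provides the base point for ping-pong.\<close>
  have "\<not> unit_circle \<subseteq> U \<union> V"
  proof
    assume "unit_circle \<subseteq> U \<union> V"
    then have "U \<inter> unit_circle = {} \<or> V \<inter> unit_circle = {}"
      using UV by (intro connectedD connected_sphere) auto
    moreover have "Fix f \<subseteq> unit_circle" "Fix g \<subseteq> unit_circle" by (auto simp: Fix_def)
    ultimately show False using UV(3,4) f(2) g(2) by blast
  qed
  then obtain p where p: "p \<in> unit_circle" "p \<notin> U" "p \<notin> V" by blast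
  obtain M where M: "\<And>k::int. k \<noteq> 0 \<Longrightarrow> ((f [^]\<^bsub>\<Gamma>\<^esub> (M::nat)) [^]\<^bsub>\<Gamma>\<^esub> k) ` (unit_circle - U) \<subseteq> U"
    using int_pow_attracted[OF f UV(1,3)] by blast
  obtain N where N: "\<And>k::int. k \<noteq> 0 \<Longrightarrow> ((g [^]\<^bsub>\<Gamma>\<^esub> (N::nat)) [^]\<^bsub>\<Gamma>\<^esub> k) ` (unit_circle - V) \<subseteq> V"
    using int_pow_attracted[OF g UV(2,4)] by blast
  show ?thesis
    by (rule ping_pong[OF _ _ UV(5) p M N]) (use f g nat_pow_closed in auto)
qed

text \<open>Cut at \<open>s\<close>, the stabilizer of \<open>s\<close> in \<open>G\<close> acts on
  the line by increasing bijections. Among them are lifts of all elements of \<open>A\<close>, so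
  their common fixed points lie over those of \<open>A\<close> and miss \<open>C\<close>; hence one
  of them displaces a compact lift of \<open>C\<close>.\<close>

lemma move_off_common_fixpoints:
  assumes A: "A \<subseteq> G" and s: "s \<in> unit_circle" "\<And>f. f \<in> A \<Longrightarrow> f s = s"
    and C: "closed C" "C \<subseteq> unit_circle" "\<And>x. x \<in> C \<Longrightarrow> \<exists>f\<in>A. f x \<noteq> x"
  shows "\<exists>h\<in>G. h s = s \<and> Fix h \<inter> C = {}"
proof -
  obtain t0 where t0: "s = cis t0" using unit_circle_cisE[OF s(1)] by metis
  \<comment> \<open>Surjectivity makes inverses available in \<open>M\<close>. Fixing both ends of
    the period lets fixed points on the circle be recognized as fixed points on the line.\<close>
  define M where "M = {F. strict_mono F \<and> surj F \<and> F t0 = t0 \<and> F (t0 + 2 * pi) = t0 + 2 * pi \<and>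
    (\<exists>h\<in>G. \<forall>t. h (cis t) = cis (F t))}"
  define K where "K = cis -` (\<Inter>f\<in>A. Fix f)"
  define L where "L = {t0..t0 + 2 * pi} \<inter> cis -` C"
  have "closed (\<Inter>f\<in>A. Fix f)" using A closed_Fix mem_homeo by blast
  then have clK: "closed K"
    unfolding K_def by (rule continuous_closed_vimage[OF _ isCont_cis])
  have L: "compact L"
    unfolding L_def by (intro compact_Int_closed compact_Icc continuous_closed_vimage[OF C(1) isCont_cis])
  have "\<exists>h\<in>M. \<forall>x\<in>L. h x \<noteq> x"
  proof (rule displace_compact[OF _ _ _ _ L clK])
    show "strict_mono k" if "k \<in> M" for k using that by (simp add: M_def)
    have "\<one>\<^bsub>\<Gamma>\<^esub> (cis t) = cis (id t)" for t
      using fun_cong[OF id_eq_one, of "cis t"] by simp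
    moreover have "\<one>\<^bsub>\<Gamma>\<^esub> \<in> G" using one_closed by simp
    ultimately show "id \<in> M" by (auto simp: M_def strict_mono_def)
    show "k \<circ> l \<in> M" if k: "k \<in> M" and l: "l \<in> M" for k l
    proof -
      obtain f h where f: "f \<in> G" "\<And>t. f (cis t) = cis (k t)"
        and h: "h \<in> G" "\<And>t. h (cis t) = cis (l t)"
        using k l by (auto simp: M_def)
      have "(f \<otimes>\<^bsub>\<Gamma>\<^esub> h) (cis t) = cis ((k \<circ> l) t)" for t
        using composition_rule[of "cis t" f h] f h by simp
      moreover have "f \<otimes>\<^bsub>\<Gamma>\<^esub> h \<in> G" using m_closed[of f h] f h by simp
      moreover have "surj (k \<circ> l)" by (rule comp_surj) (use k l in \<open>simp_all add: M_def\<close>)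
      moreover have "strict_mono (k \<circ> l)" using k l by (simp add: M_def strict_mono_def)
      moreover have "(k \<circ> l) t0 = t0" "(k \<circ> l) (t0 + 2 * pi) = t0 + 2 * pi"
        using k l by (simp_all add: M_def)
      ultimately show ?thesis unfolding M_def by blast
    qed
    show "\<exists>l\<in>M. k \<circ> l = id" if k: "k \<in> M" for k
    proof -
      let ?l = "inv_into UNIV k"
      obtain h where h: "h \<in> G" "\<And>t. h (cis t) = cis (k t)"
        and mono: "strict_mono k" and surj: "surj k"
        and ends: "k t0 = t0" "k (t0 + 2 * pi) = t0 + 2 * pi"
        using k by (auto simp: M_def)
      have inj: "inj k" using mono strict_mono_imp_inj_on by blast
      have kl: "k (?l t) = t" for t using surj by (rule surj_f_inv_f)
      have "strict_mono ?l"
        by (metis kl mono strict_mono_def strict_mono_less)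
      moreover have "?l t0 = t0" "?l (t0 + 2 * pi) = t0 + 2 * pi"
        using inv_f_f[OF inj] ends by metis+
      moreover have "surj ?l" using inj by (rule inj_imp_surj_inv)
      moreover have "(inv\<^bsub>\<Gamma>\<^esub> h) (cis t) = cis (?l t)" for t
        by (rule orbit_sym_aux) (use h kl in auto)
      moreover have "inv\<^bsub>\<Gamma>\<^esub> h \<in> G" using inv_closed[of h] h by simp
      ultimately have "?l \<in> M" by (auto simp: M_def)
      then show ?thesis using kl by (intro bexI[of _ ?l]) auto
    qed
    show "z \<in> K" if z: "\<And>k. k \<in> M \<Longrightarrow> k z = z" for z
    proof -
      have "cis z \<in> Fix f" if f: "f \<in> A" for f
      proof -
        have fG: "f \<in> G" using f A by blast
        have "f (cis t0) = cis t0" using s(2)[OF f] t0 by simp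
        then obtain F where "strict_mono F" "surj F" "F t0 = t0"
          "F (t0 + 2 * pi) = t0 + 2 * pi" and F: "\<And>t. f (cis t) = cis (F t)"
          using lift_with_fixpoint[OF mem_homeo[OF fG]] by metis
        then have "F \<in> M" using fG by (auto simp: M_def)
        from z[OF this] F[of z] show ?thesis by (simp add: Fix_def)
      qed
      then show ?thesis by (simp add: K_def)
    qed
    show "K \<inter> L = {}"
    proof (intro equals0I)
      fix t assume t: "t \<in> K \<inter> L"
      then obtain f where "f \<in> A" "f (cis t) \<noteq> cis t" using C(3)[of "cis t"] by (auto simp: L_def)
      with t show False by (auto simp: K_def Fix_def)
    qed
  qed
  then obtain F where F: "F \<in> M" "\<And>x. x \<in> L \<Longrightarrow> F x \<noteq> x" by blast
  then obtain h where h: "h \<in> G" "\<And>t. h (cis t) = cis (F t)" and mono: "strict_mono F"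
    and ends: "F t0 = t0" "F (t0 + 2 * pi) = t0 + 2 * pi"
    by (auto simp: M_def)
  \<comment> \<open>A fixed point of \<open>h\<close> lifts to some \<open>t\<close> that
    \<open>F\<close> moves by a multiple of \<open>2 * pi\<close>. As \<open>F\<close> preserves the
    half-open period from \<open>t0\<close>, the multiple is zero, so \<open>F\<close> would fix a
    point of \<open>L\<close>.\<close>
  have False if x: "x \<in> C" "h x = x" for x
  proof -
    obtain t where t: "t0 \<le> t" "t < t0 + 2 * pi" "x = cis t"
      using unit_circle_cisE[of x t0] x C(2) by blast
    have "F t0 \<le> F t" "F t < F (t0 + 2 * pi)"
      using t strict_mono_less_eq[OF mono] strict_mono_less[OF mono] by auto
    then have range: "t0 \<le> F t" "F t < t0 + 2 * pi" using ends by simp_all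
    obtain n :: int where n: "F t = t + 2 * pi * n"
      using h(2)[of t] x(2) t(3) by (auto simp: cis_eq_iff_int)
    have "2 * pi * real_of_int n < 2 * pi * 1" "2 * pi * (- 1) < 2 * pi * real_of_int n"
      using range t n by linarith+
    then have "real_of_int n < 1" "- 1 < real_of_int n"
      unfolding mult_less_cancel_left by auto
    then have "n = 0" by linarith
    then show False using F(2)[of t] n t x(1) by (auto simp: L_def)
  qed
  moreover have "h s = s" using h(2)[of t0] ends t0 by simp
  ultimately show ?thesis using h(1) by (auto simp: Fix_def)
qed

text \<open>If \<open>g\<close> moves every common fixed point of \<open>A\<close>, the preceding
  lemma with \<open>Fix g\<close> as the set to avoid yields \<open>h\<close> in \<open>G\<close>
  that fixes \<open>s\<close> but no point of \<open>Fix g\<close>. Then \<open>h\<close> and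
  \<open>g\<close> fall under the case of two maps.\<close>

lemma finite_common_fixpoint:
  assumes nofree: "\<not> has_nonabelian_free_subgroup \<Gamma>"
    and "finite A" "A \<subseteq> with_fixpoint G"
  shows "\<exists>s\<in>unit_circle. \<forall>f\<in>A. f s = s"
  using assms(2,3)
proof (induction A)
  case empty
  have "cis 0 \<in> unit_circle" by simp
  then show ?case by blast
next
  case (insert g A)
  then obtain s where s: "s \<in> unit_circle" "\<And>f. f \<in> A \<Longrightarrow> f s = s" by auto
  have g: "g \<in> G" "Fix g \<noteq> {}" and A: "A \<subseteq> G"
    using insert.prems by (auto simp: with_fixpoint_def)
  show ?case
  proof (rule ccontr)
    assume contra: "\<not> ?case"
    have "\<exists>h\<in>G. h s = s \<and> Fix h \<inter> Fix g = {}"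
      by (rule move_off_common_fixpoints[OF A s(1) _ closed_Fix[OF mem_homeo[OF g(1)]]])
        (use s(2) contra in \<open>auto simp: Fix_def\<close>)
    then obtain h where h: "h \<in> G" "h s = s" "Fix h \<inter> Fix g = {}" by blast
    have "s \<in> Fix h" using s h by (simp add: Fix_def)
    then show False using disjoint_Fix_imp_free[OF h(1) _ g h(3)] nofree by blast
  qed
qed

end

theorem lemma1p9:
  fixes G :: "(complex \<Rightarrow> complex) set"
  assumes "subgroup G HomeoPlus"
    and "\<not> has_nonabelian_free_subgroup (HomeoPlus\<lparr>carrier := G\<rparr>)"
  shows "\<forall>(n::nat) g :: nat \<Rightarrow> complex \<Rightarrow> complex.
           (\<forall>i\<in>{1..n}. g i \<in> with_fixpoint G) \<longrightarrow> (\<Inter>i\<in>{1..n}. Fix (g i)) \<noteq> {}"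
proof (intro allI impI)
  fix n :: nat and g :: "nat \<Rightarrow> complex \<Rightarrow> complex"
  assume "\<forall>i\<in>{1..n}. g i \<in> with_fixpoint G"
  then obtain s where "s \<in> unit_circle" "\<forall>f\<in>g ` {1..n}. f s = s"
    using finite_common_fixpoint[OF assms, of "g ` {1..n}"] by blast
  then have "s \<in> (\<Inter>i\<in>{1..n}. Fix (g i))" by (auto simp: Fix_def)
  then show "(\<Inter>i\<in>{1..n}. Fix (g i)) \<noteq> {}" by blast
qed

end
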